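(* Let $T\ge 2$, let $L,l$ be positive integers, and let $0\le\underline{p}\le\overline{p}$ be real numbers. Consider, for $\bm{p}=(p_1,\dots,p_T)$, $\bm{x}=(x_1,\dots,x_T)$, $\bm{u}=(u_2,\dots,u_T)$, the constraints (1) $u_t\ge x_t-x_{t-1}$ for all $t\in[2,T]$; (2) $\sum_{i=t-L+1}^{t}u_i\le x_t$ for all $t\in[L+1,T]$; (3) $\sum_{i=t-l+1}^{t}u_i\le 1-x_{t-l}$ for all $t\in[l+1,T]$; (4) $x_t\underline{p}\le p_t\le x_t\overline{p}$ for all $t\in[1,T]$; (5) $u_t\ge 0$ for all $t\in[2,T]$. Let $$\mathcal{D}=\{\bm{x}\in\{0,1\}^T,\ \bm{u}\in\{0,1\}^{T-1}\mid (1),(2),(3)\},\qquad \mathcal{X}=\{\bm{p}\in\mathbb{R}^T,\ \bm{x}\in\{0,1\}^T,\ \bm{u}\in\{0,1\}^{T-1}\mid (1),(2),(3),(4)\}.$$ If $$\mathrm{conv}(\mathcal{D})=\{\bm{x}\in\mathbb{R}^T,\ \bm{u}\in\mathbb{R}^{T-1}\mid (1),(2),(3),(5)\},$$ then $$\mathrm{conv}(\mathcal{X})=\{\bm{p}\in\mathbb{R}^T,\ \bm{x}\in\mathbb{R}^T,\ \bm{u}\in\mathbb{R}^{T-1}\mid (1),(2),(3),(4),(5)\}.$$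
   Context: The data describe a single generating unit over $T$ periods: $x_t$ is the commitment variable, $u_t$ the start-up variable (defined for $t=2,\dots,T$), $p_t$ the dispatch level, $L$ and $l$ the minimum up and down times, and $\underline{p},\overline{p}$ the minimum and maximum generation levels. Index ranges such as $[a,b]$ denote the integers from $a$ to $b$ (empty if $a>b$). $\mathrm{conv}(\cdot)$ is the convex hull. *)

theory Defs
  imports "HOL-Analysis.Analysis" "HOL-Analysis.Finite_Function_Topology"
begin

text \<open>The space of real vectors indexed by a finite set \<open>I\<close> of time periods is represented by the
  finitely supported functions from \<open>nat\<close> to \<open>real\<close> that vanish outside \<open>I\<close>. This is a linear
  subspace of a real vector space, so that the library's \<open>convex hull\<close> applies, while the number
  of periods remains an ordinary natural number.\<close>

type_synonym rvec = "nat \<Rightarrow>\<^sub>0 real"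

definition vecs :: "nat set \<Rightarrow> rvec set" where
  "vecs I = {v. Poly_Mapping.keys v \<subseteq> I}"

definition binary_vecs :: "nat set \<Rightarrow> rvec set" where
  "binary_vecs I = {v \<in> vecs I. \<forall>t\<in>I. Poly_Mapping.lookup v t \<in> {0, 1}}"

definition startup :: "nat \<Rightarrow> rvec \<Rightarrow> rvec \<Rightarrow> bool" where
  "startup T x u \<longleftrightarrow>
     (\<forall>t\<in>{2..T}. Poly_Mapping.lookup u t \<ge> Poly_Mapping.lookup x t - Poly_Mapping.lookup x (t - 1))"

text \<open>In the following two constraints the range of \<open>t\<close> ensures that the subtractions of natural
  numbers do not truncate and that only the indices \<open>2, \<dots>, T\<close> of \<open>u\<close> are summed over.\<close>

definition min_up :: "nat \<Rightarrow> nat \<Rightarrow> rvec \<Rightarrow> rvec \<Rightarrow> bool" where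
  "min_up T L x u \<longleftrightarrow>
     (\<forall>t\<in>{L+1..T}. (\<Sum>i=t-L+1..t. Poly_Mapping.lookup u i) \<le> Poly_Mapping.lookup x t)"

definition min_down :: "nat \<Rightarrow> nat \<Rightarrow> rvec \<Rightarrow> rvec \<Rightarrow> bool" where
  "min_down T l x u \<longleftrightarrow>
     (\<forall>t\<in>{l+1..T}. (\<Sum>i=t-l+1..t. Poly_Mapping.lookup u i) \<le> 1 - Poly_Mapping.lookup x (t - l))"

definition generation ::
  "nat \<Rightarrow> real \<Rightarrow> real \<Rightarrow> rvec \<Rightarrow> rvec \<Rightarrow> bool" where
  "generation T pmin pmax p x \<longleftrightarrow>
     (\<forall>t\<in>{1..T}. Poly_Mapping.lookup x t * pmin \<le> Poly_Mapping.lookup p t \<and>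
                 Poly_Mapping.lookup p t \<le> Poly_Mapping.lookup x t * pmax)"

definition startup_nonneg :: "nat \<Rightarrow> rvec \<Rightarrow> bool" where
  "startup_nonneg T u \<longleftrightarrow> (\<forall>t\<in>{2..T}. Poly_Mapping.lookup u t \<ge> 0)"

definition commitment_set ::
  "nat \<Rightarrow> nat \<Rightarrow> nat \<Rightarrow> (rvec \<times> rvec) set" where
  "commitment_set T L l =
     {(x, u). x \<in> binary_vecs {1..T} \<and> u \<in> binary_vecs {2..T} \<and>
        startup T x u \<and> min_up T L x u \<and> min_down T l x u}"

definition dispatch_set ::
  "nat \<Rightarrow> nat \<Rightarrow> nat \<Rightarrow> real \<Rightarrow> real \<Rightarrow>
     (rvec \<times> rvec \<times> rvec) set" where
  "dispatch_set T L l pmin pmax =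
     {(p, x, u). p \<in> vecs {1..T} \<and> x \<in> binary_vecs {1..T} \<and> u \<in> binary_vecs {2..T} \<and>
        startup T x u \<and> min_up T L x u \<and> min_down T l x u \<and> generation T pmin pmax p x}"

end

theory Submission
  imports Defs
begin

text \<open>Fix a point \<open>(p, x, u)\<close> of the polyhedron and let \<open>r t = p t / x t\<close> be the generation level
  relative to the commitment (arbitrary in the required range where \<open>x t = 0\<close>, which forces
  \<open>p t = 0\<close>). The linear map \<open>(x', u') \<mapsto> (r x', x', u')\<close> sends the commitment set
  into the dispatch set and \<open>(x, u)\<close> to \<open>(p, x, u)\<close>. As linear maps commute with convex hulls, any
  convex decomposition of \<open>(x, u)\<close> lifts to one of \<open>(p, x, u)\<close>.\<close>

lemma lookup_scaleR [simp]:
  fixes x :: "'a \<Rightarrow>\<^sub>0 'b::real_vector"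
  shows "Poly_Mapping.lookup (a *\<^sub>R x) i = a *\<^sub>R Poly_Mapping.lookup x i"
proof -
  have "finite {i. a *\<^sub>R Poly_Mapping.lookup x i \<noteq> 0}"
    by (rule finite_subset[OF _ finite_lookup[of x]]) auto
  then show ?thesis by (simp add: scaleR_poly_mapping_def Abs_poly_mapping_inverse)
qed

text \<open>A diagonal linear map. Writing it as a sum of \<open>single\<close> terms makes finite
  support automatic.\<close>

definition scale_on :: "nat set \<Rightarrow> (nat \<Rightarrow> real) \<Rightarrow> rvec \<Rightarrow> rvec" where
  "scale_on I r x = (\<Sum>t\<in>I. Poly_Mapping.single t (r t * Poly_Mapping.lookup x t))"

lemma lookup_scale_on:
  assumes "finite I"
  shows "Poly_Mapping.lookup (scale_on I r x) t = (if t \<in> I then r t * Poly_Mapping.lookup x t else 0)"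
  using assms by (simp add: scale_on_def lookup_sum lookup_single when_def)

lemma in_vecs_iff: "v \<in> vecs I \<longleftrightarrow> (\<forall>t. t \<notin> I \<longrightarrow> Poly_Mapping.lookup v t = 0)"
  by (auto simp: vecs_def in_keys_iff)

lemma linear_scale_on:
  assumes "finite I"
  shows "linear (scale_on I r)"
  by (rule linearI; rule poly_mapping_eqI)
    (simp_all add: assms lookup_scale_on lookup_add algebra_simps)

text \<open>Both bounds are linear in \<open>p\<close> and \<open>x\<close> jointly, since
  \<open>pmin\<close> and \<open>pmax\<close> are constants. The free component \<open>u\<close>
  only matches the type of the dispatch triples.\<close>

lemma convex_generation:
  "convex {(p, x, u). p \<in> vecs {1..T} \<and> generation T pmin pmax p x}"
proof (rule convexI, clarsimp, intro conjI)
  fix p x p' x' :: rvec and a b :: real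
  assume "0 \<le> a" "0 \<le> b"
    and p: "p \<in> vecs {Suc 0..T}" "p' \<in> vecs {Suc 0..T}"
    and g: "generation T pmin pmax p x" "generation T pmin pmax p' x'"
  show "a *\<^sub>R p + b *\<^sub>R p' \<in> vecs {Suc 0..T}"
    using p by (simp add: in_vecs_iff lookup_add)
  show "generation T pmin pmax (a *\<^sub>R p + b *\<^sub>R p') (a *\<^sub>R x + b *\<^sub>R x')"
    unfolding generation_def
  proof (intro ballI conjI)
    fix t assume t: "t \<in> {1..T}"
    let ?l = Poly_Mapping.lookup
    have "a * (?l x t * pmin) + b * (?l x' t * pmin) \<le> a * ?l p t + b * ?l p' t"
      and "a * ?l p t + b * ?l p' t \<le> a * (?l x t * pmax) + b * (?l x' t * pmax)"
      using g t \<open>0 \<le> a\<close> \<open>0 \<le> b\<close>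
      by (auto simp: generation_def intro!: add_mono mult_left_mono)
    then show "?l (a *\<^sub>R x + b *\<^sub>R x') t * pmin \<le> ?l (a *\<^sub>R p + b *\<^sub>R p') t"
      and "?l (a *\<^sub>R p + b *\<^sub>R p') t \<le> ?l (a *\<^sub>R x + b *\<^sub>R x') t * pmax"
      by (simp_all add: lookup_add algebra_simps)
  qed
qed

text \<open>Binary points lie in a closed half-space, hence so does their hull. This supplies the
  sign needed to divide the generation bounds by \<open>x t\<close>.\<close>

lemma convex_hull_commitment_nonneg:
  assumes "(x, u) \<in> convex hull (commitment_set T L l)" and "t \<in> {1..T}"
  shows "0 \<le> Poly_Mapping.lookup x t"
proof -
  have "convex {(x :: rvec, u :: rvec). 0 \<le> Poly_Mapping.lookup x t}"
    by (rule convexI) (auto simp: lookup_add)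
  moreover have "commitment_set T L l \<subseteq> {(x, u). 0 \<le> Poly_Mapping.lookup x t}"
  proof clarify
    fix y v assume "(y, v) \<in> commitment_set T L l"
    then have "Poly_Mapping.lookup y t \<in> {0, 1}"
      using assms(2) unfolding commitment_set_def binary_vecs_def by blast
    then show "0 \<le> Poly_Mapping.lookup y t" by auto
  qed
  ultimately have "convex hull (commitment_set T L l) \<subseteq> {(x, u). 0 \<le> Poly_Mapping.lookup x t}"
    by (intro hull_minimal)
  with assms(1) show ?thesis by blast
qed

lemma convex_hull_dispatch_subset:
  "convex hull (dispatch_set T L l pmin pmax) \<subseteq>
     {(p, x, u). p \<in> vecs {1..T} \<and> generation T pmin pmax p x \<and>
        (x, u) \<in> convex hull (commitment_set T L l)}" (is "_ \<subseteq> ?P")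
proof (rule hull_minimal)
  show "dispatch_set T L l pmin pmax \<subseteq> ?P"
    by (auto simp: dispatch_set_def commitment_set_def intro!: hull_inc)
  \<comment> \<open>Convexity comes from an intersection: the hull condition is a preimage under the
    linear projection that forgets \<open>p\<close>.\<close>
  have "?P = {(p, x, u). p \<in> vecs {1..T} \<and> generation T pmin pmax p x}
      \<inter> snd -` (convex hull (commitment_set T L l))"
    by auto
  then show "convex ?P"
    by (simp only: convex_Int convex_generation convex_linear_vimage linear_snd convex_convex_hull)
qed

lemma convex_hull_dispatch_supset:
  assumes "pmin \<le> pmax" and p: "p \<in> vecs {1..T}" and g: "generation T pmin pmax p x"
    and xu: "(x, u) \<in> convex hull (commitment_set T L l)"
  shows "(p, x, u) \<in> convex hull (dispatch_set T L l pmin pmax)"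
proof -
  let ?l = Poly_Mapping.lookup
  \<comment> \<open>Where the unit is off, any level in [\<open>pmin\<close>, \<open>pmax\<close>]
    would do; \<open>pmin\<close> is one because \<open>pmin \<le> pmax\<close>.\<close>
  define r where "r t = (if ?l x t = 0 then pmin else ?l p t / ?l x t)" for t
  define \<phi> where "\<phi> = (\<lambda>(x, u :: rvec). (scale_on {1..T} r x, x, u))"
  have r: "pmin \<le> r t \<and> r t \<le> pmax" if "t \<in> {1..T}" for t
    using g that assms(1) convex_hull_commitment_nonneg[OF xu that]
    by (auto simp: r_def generation_def field_simps)
  have "linear \<phi>"
    using linear_scale_on[of "{1..T}" r]
    by (auto simp: \<phi>_def linear_iff)
  moreover have "\<phi> ` commitment_set T L l \<subseteq> dispatch_set T L l pmin pmax"
  proof (rule image_subsetI)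
    fix z assume "z \<in> commitment_set T L l"
    moreover obtain y v where z: "z = (y, v)" by fastforce
    ultimately have yv: "(y, v) \<in> commitment_set T L l" by simp
    \<comment> \<open>For binary \<open>y t\<close> the product \<open>r t * y t\<close> is 0 or
      \<open>r t\<close>, so the bounds on \<open>r\<close> give the generation constraint.\<close>
    then have "?l y t = 0 \<or> ?l y t = 1" if "t \<in> {1..T}" for t
      using that by (auto simp: commitment_set_def binary_vecs_def)
    then have "generation T pmin pmax (scale_on {1..T} r y) y"
      using r by (fastforce simp: generation_def lookup_scale_on)
    then show "\<phi> z \<in> dispatch_set T L l pmin pmax"
      using yv
      by (auto simp: z \<phi>_def dispatch_set_def commitment_set_def in_vecs_iff lookup_scale_on)
  qed
  moreover have "\<phi> (x, u) = (p, x, u)"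
  proof -
    have "r t * ?l x t = ?l p t" if "t \<in> {1..T}" for t
    proof (cases "?l x t = 0")
      case True
      \<comment> \<open>With \<open>x t = 0\<close> both bounds collapse to 0 and force
        \<open>p t = 0\<close>.\<close>
      have "?l x t * pmin \<le> ?l p t \<and> ?l p t \<le> ?l x t * pmax"
        using g that unfolding generation_def by blast
      with True show ?thesis by simp
    qed (simp add: r_def)
    then have "scale_on {1..T} r x = p"
      using p by (intro poly_mapping_eqI) (auto simp: lookup_scale_on in_vecs_iff)
    then show ?thesis by (simp add: \<phi>_def)
  qed
  ultimately show ?thesis
    using in_convex_hull_linear_image[OF _ xu, of \<phi>] hull_mono by (metis subsetD)
qed

theorem theorem2:
  fixes T L l :: nat and pmin pmax :: real
  assumes "T \<ge> 2" and "L > 0" and "l > 0" and "0 \<le> pmin" and "pmin \<le> pmax"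
    and "convex hull (commitment_set T L l) =
      {(x, u). x \<in> vecs {1..T} \<and> u \<in> vecs {2..T} \<and>
         startup T x u \<and> min_up T L x u \<and> min_down T l x u \<and> startup_nonneg T u}"
  shows "convex hull (dispatch_set T L l pmin pmax) =
      {(p, x, u). p \<in> vecs {1..T} \<and> x \<in> vecs {1..T} \<and> u \<in> vecs {2..T} \<and>
         startup T x u \<and> min_up T L x u \<and> min_down T l x u \<and>
         generation T pmin pmax p x \<and> startup_nonneg T u}" (is "_ = ?P")
proof (rule subset_antisym)
  \<comment> \<open>The assumed description of the commitment hull turns membership of
    \<open>(x, u)\<close> in that hull into the linear constraints.\<close>
  show "convex hull (dispatch_set T L l pmin pmax) \<subseteq> ?P"
    using convex_hull_dispatch_subset[of T L l pmin pmax] unfolding assms(6) by blast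
  show "?P \<subseteq> convex hull (dispatch_set T L l pmin pmax)"
    using convex_hull_dispatch_supset[OF assms(5), of _ T _ _ L l] unfolding assms(6) by blast
qed

end
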